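(* Let $E$ be a divisible effect algebra with the Riesz Decomposition Property (RDP). Then a state $s$ on $E$ is extremal if and only if $$\min\{s(x),s(y)\}=\sup\{s(z):\ z\in E,\ z\le x,\ z\le y\}$$ for all $x,y\in E$.
   Context: An effect algebra is a partial algebra $(E;+,0,1)$ with a partially defined binary operation $+$ and constants $0,1$ such that for all $a,b,c\in E$: (i) $a+b$ is defined iff $b+a$ is, and then $a+b=b+a$; (ii) $a+b$ and $(a+b)+c$ are defined iff $b+c$ and $a+(b+c)$ are, and then $(a+b)+c=a+(b+c)$; (iii) for each $a$ there is a unique $a'$ with $a+a'=1$; (iv) if $a+1$ is defined then $a=0$. The partial order is $a\le b$ iff $a+c=b$ for some $c\in E$. $E$ satisfies (RDP) if $x_1+x_2=y_1+y_2$ implies there are $c_{11},c_{12},c_{21},c_{22}\in E$ with $x_1=c_{11}+c_{12}$, $x_2=c_{21}+c_{22}$, $y_1=c_{11}+c_{21}$, $y_2=c_{12}+c_{22}$. $E$ is divisible if for every positive integer $n$ and $x\in E$ there is $y\in E$ with $ny=x$ (the $n$-fold sum $y+\cdots+y$ being defined in $E$). A state on $E$ is a map $s:E\to[0,1]$ with $s(1)=1$ and $s(a+b)=s(a)+s(b)$ whenever $a+b$ is defined. A state $s$ is extremal if $s=\lambda s_1+(1-\lambda)s_2$ with $\lambda\in(0,1)$ and states $s_1,s_2$ implies $s=s_1=s_2$. *)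

theory Defs
  imports Complex_Main
begin

text \<open>
  The effect algebra \<open>E\<close> is carried by the whole type \<open>'a\<close>. The partial sum has values in
  \<open>'a option\<close>, where \<open>None\<close> means undefined and an equation between option values says that
  both sides are defined and equal or that neither is defined.
\<close>

locale effect_algebra =
  fixes padd :: "'a \<Rightarrow> 'a \<Rightarrow> 'a option"
    and zero :: 'a
    and one :: 'a
  assumes plus_commute: "padd a b = padd b a"
    and plus_assoc:
      "Option.bind (padd a b) (\<lambda>u. padd u c) = Option.bind (padd b c) (\<lambda>v. padd a v)"
    and ex1_orthosupplement: "\<exists>!a'. padd a a' = Some one"
    and plus_one_defined: "padd a one \<noteq> None \<Longrightarrow> a = zero"

definition ea_le :: "('a \<Rightarrow> 'a \<Rightarrow> 'a option) \<Rightarrow> 'a \<Rightarrow> 'a \<Rightarrow> bool" where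
  "ea_le padd a b \<longleftrightarrow> (\<exists>c. padd a c = Some b)"

definition ea_RDP :: "('a \<Rightarrow> 'a \<Rightarrow> 'a option) \<Rightarrow> bool" where
  "ea_RDP padd \<longleftrightarrow>
    (\<forall>x1 x2 y1 y2. padd x1 x2 \<noteq> None \<and> padd x1 x2 = padd y1 y2 \<longrightarrow>
      (\<exists>c11 c12 c21 c22.
        padd c11 c12 = Some x1 \<and> padd c21 c22 = Some x2 \<and>
        padd c11 c21 = Some y1 \<and> padd c12 c22 = Some y2))"

primrec ea_multiple :: "('a \<Rightarrow> 'a \<Rightarrow> 'a option) \<Rightarrow> 'a \<Rightarrow> nat \<Rightarrow> 'a \<Rightarrow> 'a option" where
  "ea_multiple padd zero 0 y = Some zero"
| "ea_multiple padd zero (Suc n) y = Option.bind (ea_multiple padd zero n y) (\<lambda>w. padd w y)"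

lemma (in effect_algebra) zero_plus: "padd zero a = Some a"
proof -
  obtain z where z: "padd one z = Some one"
    using ex1_orthosupplement by blast
  have "z = zero"
    using z plus_one_defined[of z] plus_commute[of z one] by simp
  obtain a' where a': "padd a' a = Some one"
    using ex1_orthosupplement[of a] plus_commute by metis
  have "Option.bind (padd a zero) (padd a') = Some one"
    using plus_assoc[of a' a zero] a' z \<open>z = zero\<close> by simp
  then obtain v where v: "padd a zero = Some v" "padd a' v = Some one"
    by (auto simp: bind_eq_Some_conv)
  then have "v = a"
    using ex1_orthosupplement[of a'] a' by blast
  with v show ?thesis
    by (simp add: plus_commute)
qed

text \<open>The recursion for multiples starts at \<open>zero\<close>; this agrees with starting at the
  one-fold sum \<open>y\<close>.\<close>

lemma (in effect_algebra) ea_multiple_one: "ea_multiple padd zero (Suc 0) y = Some y"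
  by (simp add: zero_plus)

definition ea_divisible :: "('a \<Rightarrow> 'a \<Rightarrow> 'a option) \<Rightarrow> 'a \<Rightarrow> bool" where
  "ea_divisible padd zero \<longleftrightarrow>
    (\<forall>n>0. \<forall>x. \<exists>y. ea_multiple padd zero n y = Some x)"

definition ea_state :: "('a \<Rightarrow> 'a \<Rightarrow> 'a option) \<Rightarrow> 'a \<Rightarrow> ('a \<Rightarrow> real) \<Rightarrow> bool" where
  "ea_state padd one s \<longleftrightarrow>
    (\<forall>a. s a \<in> {0..1}) \<and> s one = 1 \<and>
    (\<forall>a b c. padd a b = Some c \<longrightarrow> s c = s a + s b)"

definition ea_extremal_state :: "('a \<Rightarrow> 'a \<Rightarrow> 'a option) \<Rightarrow> 'a \<Rightarrow> ('a \<Rightarrow> real) \<Rightarrow> bool" where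
  "ea_extremal_state padd one s \<longleftrightarrow>
    ea_state padd one s \<and>
    (\<forall>s1 s2 l. ea_state padd one s1 \<and> ea_state padd one s2 \<and> l \<in> {0<..<1} \<and>
        s = (\<lambda>x. l * s1 x + (1 - l) * s2 x) \<longrightarrow>
      s = s1 \<and> s1 = s2)"

end

theory Submission
  imports Defs
begin

text \<open>
  If the formula for the minimum holds and \<open>s = l s1 + (1 - l) s2\<close>, then \<open>s a \<le> s b\<close> forces
  \<open>s1 a \<le> s1 b\<close>: \<open>a\<close> exceeds a common lower bound of \<open>a\<close> and \<open>b\<close> by an element on which \<open>s\<close>,
  and hence \<open>l s1\<close>, is small. Comparing with the multiples of an \<open>n\<close>-th part of the unit
  gives \<open>s1 = s\<close>.

  Conversely, let \<open>s\<close> be extremal, let \<open>c\<close> be the supremum for \<open>x, y\<close>, and suppose that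
  \<open>c < min (s x) (s y)\<close>. Set
  \<open>f w = sup\<^sub>n inf\<^sub>z sup {s v | v \<le> w, v is a sum of n elements below x - z}\<close>, where \<open>z\<close> ranges over
  the common lower bounds of \<open>x\<close> and \<open>y\<close>, a directed set by the Riesz interpolation property.
  By (RDP) \<open>f\<close> is additive, and \<open>0 \<le> f \<le> s\<close>, so \<open>f = \<lambda> s\<close> by extremality. Moreover
  \<open>f x \<ge> s x - c > 0\<close>, so \<open>\<lambda> > 0\<close>. An element below both \<open>x - z\<close> and \<open>y - z\<close> has \<open>s\<close>-value at most
  \<open>c - s z\<close>, and this yields \<open>f (y - z) \<le> c - s z\<close>. As \<open>s (y - z) \<ge> s y - c > 0\<close>, letting
  \<open>s z\<close> tend to \<open>c\<close> contradicts \<open>\<lambda> > 0\<close>.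
\<close>

section \<open>Order, cancellation and iterated sums in an effect algebra\<close>

context effect_algebra
begin

lemma assoc_right:
  assumes "padd a b = Some u" and "padd u c = Some w"
  obtains v where "padd b c = Some v" and "padd a v = Some w"
  using plus_assoc[of a b c, symmetric] assms by (auto simp: bind_eq_Some_conv)

lemma assoc_left:
  assumes "padd b c = Some v" and "padd a v = Some w"
  obtains u where "padd a b = Some u" and "padd u c = Some w"
  using plus_assoc[of a b c] assms by (auto simp: bind_eq_Some_conv)

text \<open>Adding the orthosupplement \<open>w'\<close> of \<open>w\<close> turns both
  \<open>b\<close> and \<open>c\<close> into orthosupplements of \<open>w' + a\<close>, and these
  are unique.\<close>

lemma plus_cancel_left:
  assumes "padd a b = Some w" and "padd a c = Some w"
  shows "b = c"
proof -
  obtain w' where w': "padd w' w = Some one"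
    using ex1_orthosupplement[of w] plus_commute by metis
  obtain u where u: "padd w' a = Some u" "padd u b = Some one"
    using assoc_left[OF assms(1) w'] .
  moreover obtain u' where "padd w' a = Some u'" "padd u' c = Some one"
    using assoc_left[OF assms(2) w'] .
  ultimately show ?thesis
    using ex1_orthosupplement[of u] by auto
qed

lemma le_plus_left: "padd a b = Some c \<Longrightarrow> ea_le padd a c"
  by (auto simp: ea_le_def)

lemma le_plus_right: "padd a b = Some c \<Longrightarrow> ea_le padd b c"
  using plus_commute[of a b] by (auto simp: ea_le_def)

lemma zero_le: "ea_le padd zero a"
  using zero_plus by (auto simp: ea_le_def)

lemma plus_zero: "padd a zero = Some a"
  using zero_plus plus_commute by metis

lemma le_refl: "ea_le padd a a"
  using plus_zero by (auto simp: ea_le_def)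

lemma le_trans:
  assumes "ea_le padd a b" and "ea_le padd b c"
  shows "ea_le padd a c"
proof -
  obtain d e where "padd a d = Some b" "padd b e = Some c"
    using assms by (auto simp: ea_le_def)
  then show ?thesis
    by (rule assoc_right) (auto simp: ea_le_def)
qed

lemma plus_le_right:
  assumes "padd a b = Some w" and "ea_le padd b' b"
  obtains w' where "padd a b' = Some w'" and "ea_le padd w' w"
proof -
  obtain e where "padd b' e = Some b"
    using assms(2) by (auto simp: ea_le_def)
  from assoc_left[OF this assms(1)] that show ?thesis
    by (metis le_plus_left)
qed

lemma plus_le_left:
  assumes "padd a b = Some w" and "ea_le padd a' a"
  obtains w' where "padd a' b = Some w'" and "ea_le padd w' w"
  using plus_le_right[of b a w a'] assms plus_commute by metis

lemma plus_le_mono: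
  assumes "padd a b = Some w" and "ea_le padd a' a" and "ea_le padd b' b"
  obtains w' where "padd a' b' = Some w'" and "ea_le padd w' w"
proof -
  obtain u where u: "padd a' b = Some u" "ea_le padd u w"
    using plus_le_left[OF assms(1,2)] .
  obtain w' where "padd a' b' = Some w'" "ea_le padd w' u"
    using plus_le_right[OF u(1) assms(3)] .
  with u that show ?thesis
    using le_trans by blast
qed

text \<open>The number of summands is kept as an index because a bound on the state of each summand
  then bounds the state of the whole sum.\<close>

primrec nfold_sums :: "'a set \<Rightarrow> nat \<Rightarrow> 'a set" where
  "nfold_sums A 0 = {zero}"
| "nfold_sums A (Suc n) = {w. \<exists>u \<in> nfold_sums A n. \<exists>d \<in> A. padd u d = Some w}"

lemma nfold_sums_mono: "A \<subseteq> B \<Longrightarrow> nfold_sums A n \<subseteq> nfold_sums B n"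
  by (induction n) auto

lemma nfold_sums_one: "d \<in> A \<Longrightarrow> d \<in> nfold_sums A 1"
  by (auto simp: zero_plus)

lemma zero_in_nfold_sums: "zero \<in> A \<Longrightarrow> zero \<in> nfold_sums A n"
  by (induction n) (use zero_plus in auto)

lemma nfold_sums_plus:
  "\<lbrakk>u \<in> nfold_sums A n; v \<in> nfold_sums A m; padd u v = Some w\<rbrakk> \<Longrightarrow> w \<in> nfold_sums A (n + m)"
proof (induction m arbitrary: v w)
  case 0
  then show ?case
    using plus_zero by auto
next
  case (Suc m)
  then obtain v' d where v': "v' \<in> nfold_sums A m" "d \<in> A" "padd v' d = Some v"
    by auto
  obtain u' where "padd u v' = Some u'" "padd u' d = Some w"
    using assoc_left[OF v'(3) Suc.prems(3)] .
  with Suc.IH[OF Suc.prems(1) v'(1)] v'(2) show ?case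
    by auto
qed

text \<open>Membership of \<open>zero\<close> guarantees that the suprema in \<open>part\<close>
  below are taken over nonempty sets.\<close>

definition downset :: "'a set \<Rightarrow> bool" where
  "downset A \<longleftrightarrow> zero \<in> A \<and> (\<forall>d \<in> A. \<forall>e. ea_le padd e d \<longrightarrow> e \<in> A)"

end

section \<open>Consequences of Riesz decomposition\<close>

locale rdp_effect_algebra = effect_algebra +
  assumes rdp: "ea_RDP padd"
begin

lemma decompose:
  assumes "padd x1 x2 = Some w" and "padd y1 y2 = Some w"
  obtains c11 c12 c21 c22 where "padd c11 c12 = Some x1" and "padd c21 c22 = Some x2"
    and "padd c11 c21 = Some y1" and "padd c12 c22 = Some y2"
  using rdp assms unfolding ea_RDP_def by (metis option.distinct(1))

lemma le_plus_decompose: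
  assumes "ea_le padd v w" and "padd w1 w2 = Some w"
  obtains v1 v2 where "padd v1 v2 = Some v" and "ea_le padd v1 w1" and "ea_le padd v2 w2"
proof -
  obtain r where "padd v r = Some w"
    using assms(1) by (auto simp: ea_le_def)
  from decompose[OF this assms(2)] that show ?thesis
    by (metis le_plus_left)
qed

text \<open>By (RDP) an element below \<open>v' + d\<close> splits into a piece below
  \<open>v'\<close> and a piece below \<open>d\<close>, so the number of summands does not
  grow.\<close>

lemma nfold_sums_downward:
  assumes "downset A"
  shows "\<lbrakk>v \<in> nfold_sums A n; ea_le padd u v\<rbrakk> \<Longrightarrow> u \<in> nfold_sums A n"
proof (induction n arbitrary: u v)
  case 0
  then obtain r where "padd u r = Some zero"
    by (auto simp: ea_le_def)
  \<comment> \<open>Adding the unit to \<open>u + r = zero\<close> shows that \<open>r + one\<close>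
    is defined, which forces \<open>r = zero\<close>.\<close>
  moreover have "padd zero one = Some one"
    by (rule zero_plus)
  ultimately obtain w where "padd r one = Some w" "padd u w = Some one"
    by (rule assoc_right)
  then have "r = zero"
    using plus_one_defined by simp
  then show ?case
    using \<open>padd u r = Some zero\<close> plus_zero by simp
next
  case (Suc n)
  then obtain v' d where v': "v' \<in> nfold_sums A n" "d \<in> A" "padd v' d = Some v"
    by auto
  obtain u' e where u': "padd u' e = Some u" "ea_le padd u' v'" "ea_le padd e d"
    using le_plus_decompose[OF Suc.prems(2) v'(3)] .
  have "u' \<in> nfold_sums A n" "e \<in> A"
    using Suc.IH[OF v'(1) u'(2)] u'(3) v'(2) assms by (auto simp: downset_def)
  with u'(1) show ?case
    by auto
qed

text \<open>Two refinements are used. The first, inside \<open>x\<close>, gives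
  \<open>z1 = c11 + c12\<close> and \<open>z2 = c11 + c21\<close>. Cancelling \<open>c11\<close> in
  \<open>y\<close> leaves \<open>c12 + b1 = c21 + b2\<close>, whose refinement splits off a common
  part \<open>d11\<close> of \<open>c12\<close> and \<open>c21\<close>. The interpolant is
  \<open>z = c11 + d11 + d12 + d21\<close>, which equals both \<open>z1 + d21\<close> and
  \<open>z2 + d12\<close>. It is below \<open>y\<close> since \<open>d21 <= b1\<close>, and below
  \<open>x\<close> since \<open>d21 <= c21 <= a1\<close>.\<close>

lemma interpolation:
  assumes "ea_le padd z1 x" and "ea_le padd z2 x" and "ea_le padd z1 y" and "ea_le padd z2 y"
  obtains z where "ea_le padd z1 z" and "ea_le padd z2 z" and "ea_le padd z x" and "ea_le padd z y"
proof -
  obtain a1 a2 b1 b2 where ab: "padd z1 a1 = Some x" "padd z2 a2 = Some x"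
    "padd z1 b1 = Some y" "padd z2 b2 = Some y"
    using assms by (auto simp: ea_le_def)
  obtain c11 c12 c21 c22 where c: "padd c11 c12 = Some z1" "padd c21 c22 = Some a1"
    "padd c11 c21 = Some z2" "padd c12 c22 = Some a2"
    using decompose[OF ab(1,2)] .
  obtain v where v: "padd c12 b1 = Some v" "padd c11 v = Some y"
    using assoc_right[OF c(1) ab(3)] .
  obtain v' where v': "padd c21 b2 = Some v'" "padd c11 v' = Some y"
    using assoc_right[OF c(3) ab(4)] .
  have "v' = v"
    using plus_cancel_left[OF v'(2) v(2)] .
  with v'(1) obtain d11 d12 d21 d22 where d: "padd d11 d12 = Some c12" "padd d21 d22 = Some b1"
    "padd d11 d21 = Some c21" "padd d12 d22 = Some b2"
    using decompose[OF v(1)] by metis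
  obtain z where z: "padd z1 d21 = Some z" "ea_le padd z y"
    using plus_le_right[OF ab(3) le_plus_left[OF d(2)]] .
  have "ea_le padd z x"
    using plus_le_right[OF ab(1) le_trans[OF le_plus_right[OF d(3)] le_plus_left[OF c(2)]]] z(1)
    by auto
  moreover have "ea_le padd z2 z"
  proof -
    obtain p where p: "padd c12 d21 = Some p" "padd c11 p = Some z"
      using assoc_right[OF c(1) z(1)] .
    have "padd d12 d11 = Some c12"
      using d(1) plus_commute by metis
    then obtain q where q: "padd d11 d21 = Some q" "padd d12 q = Some p"
      using assoc_right p(1) by metis
    have "padd c21 d12 = Some p"
      using q d(3) plus_commute by simp
    then show ?thesis
      using assoc_left[OF _ p(2)] c(3) by (metis le_plus_left option.inject)
  qed
  ultimately show ?thesis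
    using that z le_plus_left by blast
qed

end

section \<open>States and extremality\<close>

locale effect_algebra_state = effect_algebra +
  fixes s :: "'a \<Rightarrow> real"
  assumes state: "ea_state padd one s"
begin

lemma state_nonneg: "0 \<le> s a" and state_le_one: "s a \<le> 1" and state_one: "s one = 1"
  and state_plus: "padd a b = Some c \<Longrightarrow> s c = s a + s b"
  using state by (auto simp: ea_state_def)

lemma state_zero: "s zero = 0"
  using state_plus[OF zero_plus[of zero]] by simp

lemma state_mono: "ea_le padd a b \<Longrightarrow> s a \<le> s b"
  by (auto simp: ea_le_def dest!: state_plus intro: state_nonneg)

lemma bdd_above_state: "bdd_above (s ` A)"
  by (auto intro!: bdd_aboveI[of _ 1] state_le_one)

lemma state_multiple: "ea_multiple padd zero n y = Some x \<Longrightarrow> s x = n * s y"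
  by (induction n arbitrary: x)
    (auto simp: state_zero bind_eq_Some_conv algebra_simps dest!: state_plus)

text \<open>If \<open>0 < f one < 1\<close>, the normalisations of \<open>f\<close> and
  \<open>s - f\<close> are states with \<open>s\<close> as a convex combination, so extremality
  identifies the first with \<open>s\<close>. At the two endpoints one of them cannot be normalised,
  but there \<open>f\<close> is 0 or \<open>s\<close>.\<close>

lemma dominated_additive_proportional:
  assumes ext: "ea_extremal_state padd one s"
    and f0: "\<And>a. 0 \<le> f a" and fs: "\<And>a. f a \<le> s a"
    and fplus: "\<And>a b c. padd a b = Some c \<Longrightarrow> f c = f a + f b"
  shows "f a = f one * s a"
proof -
  have comp: "\<exists>b. padd a b = Some one" for a
    using ex1_orthosupplement[of a] by blast
  have f_le: "f a \<le> f one" for a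
    using comp[of a] fplus f0 by fastforce
  have sf_le: "s a - f a \<le> 1 - f one" for a
  proof -
    obtain b where "padd a b = Some one"
      using comp by blast
    then show ?thesis
      using fplus[of a b one] fs[of b] state_plus[of a b one] state_one by linarith
  qed
  consider "f one = 0" | "f one = 1" | "0 < f one" "f one < 1"
    using f0[of one] fs[of one] state_one by fastforce
  then show ?thesis
  proof cases
    case 1
    then show ?thesis
      using f_le[of a] f0[of a] by simp
  next
    case 2
    then show ?thesis
      using sf_le[of a] fs[of a] by simp
  next
    case 3
    let ?l = "f one"
    have 1: "ea_state padd one (\<lambda>a. f a / ?l)"
      using 3 f0 f_le by (auto simp: ea_state_def fplus add_divide_distrib)
    have 2: "ea_state padd one (\<lambda>a. (s a - f a) / (1 - ?l))"
      using 3 fs sf_le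
      by (auto simp: ea_state_def state_one fplus state_plus simp flip: add_divide_distrib)
    have "s = (\<lambda>a. ?l * (f a / ?l) + (1 - ?l) * ((s a - f a) / (1 - ?l)))"
      using 3 by auto
    with ext 1 2 3 have "s = (\<lambda>a. f a / ?l)"
      unfolding ea_extremal_state_def greaterThanLessThan_iff by blast
    then have "s a = f a / ?l"
      by metis
    with 3 show ?thesis
      by simp
  qed
qed

section \<open>From the minimum formula to extremality\<close>

lemma extremal_if_min_formula:
  assumes div: "ea_divisible padd zero"
    and min: "\<And>x y. min (s x) (s y) = Sup {s z | z. ea_le padd z x \<and> ea_le padd z y}"
  shows "ea_extremal_state padd one s"
proof -
  have left: "s1 = s"
    if s1: "ea_state padd one s1" and s2: "ea_state padd one s2"
      and l: "0 < l" "l < 1" and s_eq: "s = (\<lambda>x. l * s1 x + (1 - l) * s2 x)"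
    for s1 s2 l
  proof
    fix x
    interpret s1: effect_algebra_state padd zero one s1
      by unfold_locales (rule s1)
    interpret s2: effect_algebra_state padd zero one s2
      by unfold_locales (rule s2)
    have dom: "l * s1 a \<le> s a" for a
      using l s2.state_nonneg[of a] by (simp add: s_eq)
    have mono: "s1 a \<le> s1 b" if "s a \<le> s b" for a b
    proof -
      have "l * s1 a \<le> l * s1 b + e" if "e > 0" for e
      proof -
        let ?S = "{s z | z. ea_le padd z a \<and> ea_le padd z b}"
        have "Sup ?S = s a"
          unfolding min[of a b, symmetric] by (rule min_absorb1[OF \<open>s a \<le> s b\<close>])
        then have "s a - e < Sup ?S"
          using that by linarith
        moreover have "s zero \<in> ?S"
          by (intro CollectI exI[of _ zero] conjI refl zero_le)
        then have "?S \<noteq> {}"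
          by (metis empty_iff)
        ultimately obtain r where "r \<in> ?S" "s a - e < r"
          by (rule less_cSupE)
        then obtain z where z: "ea_le padd z a" "ea_le padd z b" "s a - e < s z"
          by (elim CollectE exE conjE) simp
        then obtain d where d: "padd z d = Some a"
          by (auto simp: ea_le_def)
        have "l * s1 a = l * s1 z + l * s1 d"
          using s1.state_plus[OF d] by (simp add: algebra_simps)
        also have "\<dots> \<le> l * s1 b + s d"
          using s1.state_mono[OF z(2)] l dom[of d] by (simp add: add_mono)
        also have "\<dots> \<le> l * s1 b + e"
          using state_plus[OF d] z(3) by simp
        finally show ?thesis .
      qed
      then have "l * s1 a \<le> l * s1 b"
        by (rule field_le_epsilon)
      with l show ?thesis
        by simp
    qed
    \<comment> \<open>The multiples of an \<open>n\<close>-th part \<open>y\<close> of the unit form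
      a scale on which \<open>s\<close> and \<open>s1\<close> agree. With \<open>k\<close> the floor
      of \<open>n * s x\<close>, monotonicity places \<open>s1 x\<close> in the same interval from
      \<open>k / n\<close> to \<open>(k + 1) / n\<close> as \<open>s x\<close>.\<close>
    have close: "\<bar>s1 x - s x\<bar> \<le> 1 / real n" if n: "n > 0" for n :: nat
    proof -
      obtain y where y: "ea_multiple padd zero n y = Some one"
        using div n unfolding ea_divisible_def by blast
      \<comment> \<open>The induction runs downward from \<open>n\<close>: if a multiple is defined,
        so is the one before it.\<close>
      have mult: "\<exists>m. ea_multiple padd zero k y = Some m" if "k \<le> n" for k
        using that y
        by (induction rule: inc_induct) (auto simp: bind_eq_Some_conv)
      have vals: "\<exists>m. s m = real k / n \<and> s1 m = real k / n" if k: "k \<le> n" for k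
      proof -
        obtain m where "ea_multiple padd zero k y = Some m"
          using mult[OF k] by blast
        then have "s m = k * s y" "s1 m = k * s1 y"
          using state_multiple s1.state_multiple by blast+
        moreover have "s y = 1 / n" "s1 y = 1 / n"
          using state_multiple[OF y] s1.state_multiple[OF y] state_one s1.state_one \<open>n > 0\<close>
          by (simp_all add: field_simps)
        ultimately show ?thesis
          by auto
      qed
      define k where "k = nat \<lfloor>n * s x\<rfloor>"
      have k: "real k \<le> n * s x" "n * s x < real k + 1"
        using state_nonneg[of x] by (auto simp: k_def)
      have "n * s x \<le> n"
        using state_le_one[of x] by (simp add: mult_left_le)
      then have "k \<le> n"
        using k(1) by linarith
      have lower: "real k / n \<le> s1 x"
      proof -
        obtain m where "s m = real k / n" "s1 m = real k / n"
          using vals[OF \<open>k \<le> n\<close>] by blast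
        then show ?thesis
          using mono[of m x] k(1) that by (simp add: divide_le_eq mult.commute)
      qed
      \<comment> \<open>For \<open>k = n\<close> the scale has no next element, but then the bound
        exceeds 1.\<close>
      have upper: "s1 x \<le> (real k + 1) / n"
      proof (cases "k = n")
        case True
        then have "1 \<le> (real k + 1) / n"
          using n by simp
        then show ?thesis
          using s1.state_le_one[of x] by linarith
      next
        case False
        with \<open>k \<le> n\<close> obtain m where "s m = (real k + 1) / n" "s1 m = (real k + 1) / n"
          using vals[of "Suc k"] by (auto simp: add.commute)
        moreover have "s x \<le> (real k + 1) / n"
          using k(2) that by (simp add: le_divide_eq mult.commute)
        ultimately show ?thesis
          using mono[of x m] by simp
      qed
      have "real k / n \<le> s x" "s x \<le> (real k + 1) / n"
        using k that by (auto simp: field_simps)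
      with lower upper show ?thesis
        by (simp add: add_divide_distrib)
    qed
    have "\<bar>s1 x - s x\<bar> \<le> 0 + e" if e: "e > 0" for e
    proof -
      obtain n where "n > 0" "inverse (real n) < e"
        using ex_inverse_of_nat_less[OF e] by blast
      with close[of n] show ?thesis
        by (simp add: inverse_eq_divide)
    qed
    then have "\<bar>s1 x - s x\<bar> \<le> 0"
      by (rule field_le_epsilon)
    then show "s1 x = s x"
      by simp
  qed
  have "s = s1 \<and> s1 = s2"
    if "ea_state padd one s1" "ea_state padd one s2" "l \<in> {0<..<1}"
      and s_eq: "s = (\<lambda>x. l * s1 x + (1 - l) * s2 x)" for s1 s2 l
  proof -
    have "s1 = s"
      using left[of s1 s2 l] that by auto
    moreover have "s2 = s"
      using left[of s2 s1 "1 - l"] that by (auto simp: add.commute)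
    ultimately show ?thesis
      by simp
  qed
  with state show ?thesis
    unfolding ea_extremal_state_def by blast
qed

end

section \<open>Truncations of a state and their limit\<close>

locale rdp_effect_algebra_state = rdp_effect_algebra + effect_algebra_state
begin

text \<open>A substitute for the state of a meet of \<open>w\<close> with an \<open>n\<close>-fold
  multiple, since such meets need not exist.\<close>

definition part :: "'a set \<Rightarrow> nat \<Rightarrow> 'a \<Rightarrow> real" where
  "part A n w = (SUP v \<in> {v \<in> nfold_sums A n. ea_le padd v w}. s v)"

lemma part_upper: "\<lbrakk>v \<in> nfold_sums A n; ea_le padd v w\<rbrakk> \<Longrightarrow> s v \<le> part A n w"
  unfolding part_def by (rule cSUP_upper) (auto intro: bdd_above_state)

lemma part_least:
  assumes "downset A" and "\<And>v. \<lbrakk>v \<in> nfold_sums A n; ea_le padd v w\<rbrakk> \<Longrightarrow> s v \<le> r"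
  shows "part A n w \<le> r"
  unfolding part_def
  using assms zero_in_nfold_sums[of A n] zero_le[of w]
  by (intro cSUP_least) (auto simp: downset_def)

lemma part_nonneg: "downset A \<Longrightarrow> 0 \<le> part A n w"
  using part_upper[of zero A n w] zero_in_nfold_sums zero_le by (simp add: downset_def state_zero)

lemma part_le_state: "downset A \<Longrightarrow> part A n w \<le> s w"
  by (rule part_least) (auto intro: state_mono)

lemma part_mono: "\<lbrakk>downset A; A \<subseteq> B\<rbrakk> \<Longrightarrow> part A n w \<le> part B n w"
  by (rule part_least) (use nfold_sums_mono[of A B n] in \<open>auto intro!: part_upper\<close>)

lemma part_subadditive:
  assumes A: "downset A" and w: "padd w1 w2 = Some w"
  shows "part A n w \<le> part A n w1 + part A n w2"
proof (rule part_least[OF A])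
  fix v assume v: "v \<in> nfold_sums A n" "ea_le padd v w"
  obtain v1 v2 where d: "padd v1 v2 = Some v" "ea_le padd v1 w1" "ea_le padd v2 w2"
    using le_plus_decompose[OF v(2) w] .
  have "v1 \<in> nfold_sums A n" "v2 \<in> nfold_sums A n"
    using nfold_sums_downward[OF A v(1)] d(1) le_plus_left le_plus_right by blast+
  then show "s v \<le> part A n w1 + part A n w2"
    using part_upper d state_plus[OF d(1)] by (simp add: add_mono)
qed

text \<open>Adding an \<open>n\<close>-fold and an \<open>m\<close>-fold sum costs
  \<open>n + m\<close> summands; the supremum over the index in \<open>limit_part\<close> absorbs
  this growth.\<close>

lemma part_superadditive:
  assumes A: "downset A" and w: "padd w1 w2 = Some w"
  shows "part A n w1 + part A m w2 \<le> part A (n + m) w"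
proof -
  have "s v1 + s v2 \<le> part A (n + m) w"
    if v: "v1 \<in> nfold_sums A n" "ea_le padd v1 w1" "v2 \<in> nfold_sums A m" "ea_le padd v2 w2"
    for v1 v2
  proof -
    obtain v where "padd v1 v2 = Some v" "ea_le padd v w"
      using plus_le_mono[OF w v(2,4)] .
    with v show ?thesis
      using part_upper nfold_sums_plus state_plus by metis
  qed
  \<comment> \<open>The two suprema are bounded one after the other, first with \<open>v2\<close>
    fixed.\<close>
  then have "part A n w1 \<le> part A (n + m) w - s v2"
    if "v2 \<in> nfold_sums A m" "ea_le padd v2 w2" for v2
    by (intro part_least[OF A]) (use that in \<open>auto simp: le_diff_eq\<close>)
  then have "s v2 \<le> part A (n + m) w - part A n w1"
    if "v2 \<in> nfold_sums A m" "ea_le padd v2 w2" for v2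
    using that by (simp add: le_diff_eq add.commute)
  then have "part A m w2 \<le> part A (n + m) w - part A n w1"
    by (rule part_least[OF A])
  then show ?thesis
    by simp
qed

text \<open>Every summand of an element below \<open>w\<close> is itself below \<open>w\<close>, so
  \<open>e\<close> has to bound only such members of \<open>A\<close>.\<close>

lemma part_le_multiple:
  assumes A: "downset A" and e: "\<And>d. \<lbrakk>d \<in> A; ea_le padd d w\<rbrakk> \<Longrightarrow> s d \<le> e"
  shows "part A n w \<le> n * e"
proof -
  have "s v \<le> n * e" if "v \<in> nfold_sums A n" "ea_le padd v w" for v
    using that
  proof (induction n arbitrary: v)
    case 0
    then show ?case
      by (simp add: state_zero)
  next
    case (Suc n)
    then obtain u d where u: "u \<in> nfold_sums A n" "d \<in> A" "padd u d = Some v"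
      by auto
    have "ea_le padd u w" "ea_le padd d w"
      using u(3) Suc.prems(2) le_plus_left le_plus_right le_trans by blast+
    then show ?case
      using Suc.IH[OF u(1)] e[OF u(2)] state_plus[OF u(3)] by (simp add: algebra_simps)
  qed
  then show ?thesis
    by (rule part_least[OF A])
qed

text \<open>The infimum stands inside the supremum, so for each \<open>n\<close> the set
  \<open>A\<close> may be chosen depending on \<open>n\<close>.\<close>

definition limit_part :: "'a set set \<Rightarrow> 'a \<Rightarrow> real" where
  "limit_part F w = (SUP n. INF A \<in> F. part A n w)"

context
  fixes F :: "'a set set"
  assumes F_ne: "F \<noteq> {}" and F_down: "\<And>A. A \<in> F \<Longrightarrow> downset A"
    and F_directed: "\<And>A B. \<lbrakk>A \<in> F; B \<in> F\<rbrakk> \<Longrightarrow> \<exists>C \<in> F. C \<subseteq> A \<inter> B"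
begin

lemma INF_part_lower: "A \<in> F \<Longrightarrow> (INF A \<in> F. part A n w) \<le> part A n w"
  by (rule cINF_lower) (auto intro!: bdd_belowI[of _ 0] part_nonneg F_down)

lemma INF_part_greatest: "(\<And>A. A \<in> F \<Longrightarrow> r \<le> part A n w) \<Longrightarrow> r \<le> (INF A \<in> F. part A n w)"
  by (rule cINF_greatest[OF F_ne])

lemma INF_part_le_state: "(INF A \<in> F. part A n w) \<le> s w"
  using F_ne INF_part_lower part_le_state F_down by (meson all_not_in_conv order_trans)

lemma limit_part_upper: "(INF A \<in> F. part A n w) \<le> limit_part F w"
  unfolding limit_part_def
  by (rule cSUP_upper) (auto intro!: bdd_aboveI[of _ "s w"] INF_part_le_state)

lemma limit_part_least: "(\<And>n. (INF A \<in> F. part A n w) \<le> r) \<Longrightarrow> limit_part F w \<le> r"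
  unfolding limit_part_def by (rule cSUP_least) auto

lemma limit_part_le_state: "limit_part F w \<le> s w"
  by (rule limit_part_least) (rule INF_part_le_state)

lemma limit_part_nonneg: "0 \<le> limit_part F w"
  using INF_part_greatest[of 0 0 w] limit_part_upper[of 0 w] part_nonneg F_down by fastforce

text \<open>Subadditivity holds at each fixed \<open>n\<close>, because two members of
  \<open>F\<close> can be replaced by one contained in both. Superadditivity uses a single member
  and passes from \<open>n\<close> and \<open>m\<close> to \<open>n + m\<close>.\<close>

lemma limit_part_plus:
  assumes w: "padd w1 w2 = Some w"
  shows "limit_part F w = limit_part F w1 + limit_part F w2"
proof (rule antisym)
  let ?q = "\<lambda>n w. INF A \<in> F. part A n w"
  have sub: "?q n w \<le> ?q n w1 + ?q n w2" for n
  proof -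
    have "?q n w \<le> part A n w1 + part B n w2" if AB: "A \<in> F" "B \<in> F" for A B
    proof -
      obtain C where C: "C \<in> F" "C \<subseteq> A" "C \<subseteq> B"
        using F_directed[OF AB] by auto
      have "?q n w \<le> part C n w1 + part C n w2"
        using INF_part_lower[OF C(1)] part_subadditive[OF F_down[OF C(1)] w] order_trans by blast
      also have "\<dots> \<le> part A n w1 + part B n w2"
        using C F_down by (intro add_mono part_mono) auto
      finally show ?thesis .
    qed
    then have "?q n w - part B n w2 \<le> ?q n w1" if "B \<in> F" for B
      by (intro INF_part_greatest) (use that in \<open>auto simp: diff_le_eq\<close>)
    then have "?q n w - ?q n w1 \<le> part B n w2" if "B \<in> F" for B
      using that by (simp add: diff_le_eq add.commute)
    then have "?q n w - ?q n w1 \<le> ?q n w2"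
      by (rule INF_part_greatest)
    then show ?thesis
      by simp
  qed
  show "limit_part F w \<le> limit_part F w1 + limit_part F w2"
    by (rule limit_part_least) (rule order_trans[OF sub add_mono[OF limit_part_upper limit_part_upper]])
  have "?q n w1 + ?q m w2 \<le> limit_part F w" for n m
  proof -
    have "?q n w1 + ?q m w2 \<le> part A (n + m) w" if "A \<in> F" for A
      by (rule order_trans[OF add_mono[OF INF_part_lower[OF that] INF_part_lower[OF that]]
            part_superadditive[OF F_down[OF that] w]])
    then have "?q n w1 + ?q m w2 \<le> ?q (n + m) w"
      by (rule INF_part_greatest)
    then show ?thesis
      using limit_part_upper order_trans by blast
  qed
  then have "limit_part F w1 \<le> limit_part F w - ?q m w2" for m
    by (intro limit_part_least) (simp add: le_diff_eq)
  then have "?q m w2 \<le> limit_part F w - limit_part F w1" for m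
    by (simp add: le_diff_eq add.commute)
  then have "limit_part F w2 \<le> limit_part F w - limit_part F w1"
    by (rule limit_part_least)
  then show "limit_part F w1 + limit_part F w2 \<le> limit_part F w"
    by simp
qed

end

section \<open>From extremality to the minimum formula\<close>

lemma min_formula_if_extremal:
  assumes ext: "ea_extremal_state padd one s"
  shows "min (s x) (s y) = Sup {s z | z. ea_le padd z x \<and> ea_le padd z y}"
proof -
  define Z where "Z = {z. ea_le padd z x \<and> ea_le padd z y}"
  define c where "c = Sup (s ` Z)"
  have Z_zero: "zero \<in> Z"
    by (simp add: Z_def zero_le)
  have le_c: "s z \<le> c" if "z \<in> Z" for z
    unfolding c_def using that by (intro cSup_upper bdd_above_state) auto
  have exceeds: "\<exists>z \<in> Z. r < s z" if "r < c" for r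
    using that Z_zero less_cSupD[of "s ` Z" r] by (fastforce simp: c_def)
  have c_le: "c \<le> min (s x) (s y)"
    unfolding c_def using Z_zero by (intro cSup_least) (auto simp: Z_def intro: state_mono)
  have "\<not> c < min (s x) (s y)"
  proof
    assume less: "c < min (s x) (s y)"
    \<comment> \<open>For \<open>z\<close> in \<open>Z\<close> these are, by cancellation, the
      elements below \<open>x - z\<close>, described without naming the difference.\<close>
    define A where "A z = {d. \<exists>u. padd z d = Some u \<and> ea_le padd u x}" for z
    have A_down: "downset (A z)" if "z \<in> Z" for z
      unfolding downset_def
    proof (intro conjI ballI allI impI)
      show "zero \<in> A z"
        using that plus_zero by (auto simp: A_def Z_def)
      fix d e assume "d \<in> A z" "ea_le padd e d"
      then obtain u where u: "padd z d = Some u" "ea_le padd u x"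
        by (auto simp: A_def)
      obtain u' where "padd z e = Some u'" "ea_le padd u' u"
        using plus_le_right[OF u(1) \<open>ea_le padd e d\<close>] .
      with u(2) show "e \<in> A z"
        unfolding A_def using le_trans by blast
    qed
    have A_antimono: "A z' \<subseteq> A z" if le: "ea_le padd z z'" for z z'
    proof
      fix d assume "d \<in> A z'"
      then obtain u where u: "padd z' d = Some u" "ea_le padd u x"
        by (auto simp: A_def)
      obtain u' where "padd z d = Some u'" "ea_le padd u' u"
        using plus_le_left[OF u(1) le] .
      with u(2) show "d \<in> A z"
        unfolding A_def using le_trans by blast
    qed
    have Z_directed: "\<exists>z \<in> Z. ea_le padd z1 z \<and> ea_le padd z2 z" if "z1 \<in> Z" "z2 \<in> Z" for z1 z2
      using that interpolation[of z1 x z2 y] unfolding Z_def by blast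
    let ?F = "A ` Z"
    have F_ne: "?F \<noteq> {}"
      using Z_zero by auto
    have F_down: "downset B" if "B \<in> ?F" for B
      using that A_down by auto
    have F_directed: "\<exists>D \<in> ?F. D \<subseteq> B \<inter> C" if BC: "B \<in> ?F" "C \<in> ?F" for B C
    proof -
      obtain z1 z2 where "z1 \<in> Z" "z2 \<in> Z" "B = A z1" "C = A z2"
        using BC by blast
      moreover from this obtain z where "z \<in> Z" "ea_le padd z1 z" "ea_le padd z2 z"
        using Z_directed by blast
      ultimately show ?thesis
        using A_antimono by blast
    qed
    note F = F_ne F_down F_directed
    let ?f = "limit_part ?F"
    have f_eq: "?f w = ?f one * s w" for w
      by (rule dominated_additive_proportional[OF ext limit_part_nonneg[OF F]
            limit_part_le_state[OF F] limit_part_plus[OF F]])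
    \<comment> \<open>One summand suffices: \<open>x - z\<close> itself lies in \<open>A z\<close>
      and below \<open>x\<close>, and \<open>s z <= c\<close>.\<close>
    have "s x - c \<le> ?f x"
    proof -
      have "s x - c \<le> part (A z) 1 x" if z: "z \<in> Z" for z
      proof -
        obtain a where a: "padd z a = Some x"
          using z by (auto simp: Z_def ea_le_def)
        have "s a \<le> part (A z) 1 x"
          using a le_refl by (intro part_upper nfold_sums_one le_plus_right[OF a]) (auto simp: A_def)
        then show ?thesis
          using state_plus[OF a] le_c[OF z] by simp
      qed
      then have "s x - c \<le> (INF B \<in> ?F. part B 1 x)"
        by (intro INF_part_greatest[OF F]) auto
      then show ?thesis
        using limit_part_upper[OF F] order_trans by blast
    qed
    then have "0 < ?f one * s x"
      using less f_eq[of x] by simp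
    then have pos: "0 < ?f one"
      using state_nonneg[of x] by (simp add: zero_less_mult_iff)
    \<comment> \<open>For \<open>z'\<close> above \<open>z\<close>, split \<open>b\<close> into
      \<open>t = z' - z\<close> and \<open>b' = y - z'\<close>. If \<open>d\<close> in
      \<open>A z'\<close> is below \<open>b'\<close>, then \<open>z' + d\<close> is a common lower
      bound of \<open>x\<close> and \<open>y\<close>, so \<open>s d <= c - s z'\<close>. Hence only
      \<open>t\<close> contributes substantially.\<close>
    have f_small: "?f b \<le> c - s z" if z: "z \<in> Z" and b: "padd z b = Some y" for z b
    proof (rule limit_part_least[OF F])
      fix n
      have "(INF B \<in> ?F. part B n b) \<le> c - s z + e" if "e > 0" for e
      proof -
        \<comment> \<open>The allowed error per summand depends on \<open>n\<close>, and
          \<open>z'\<close> is chosen afterwards. The denominator \<open>n + 1\<close> also covers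
          \<open>n = 0\<close>.\<close>
        define r where "r = e / (real n + 1)"
        have r: "r > 0" "n * r \<le> e"
          using \<open>e > 0\<close> by (auto simp: r_def field_simps)
        obtain z0 where "z0 \<in> Z" "c - r < s z0"
          using exceeds[of "c - r"] r(1) by auto
        then obtain z' where z': "z' \<in> Z" "ea_le padd z z'" "c - r < s z'"
          using Z_directed[OF z] state_mono by (metis order_less_le_trans)
        obtain t b' where t: "padd z t = Some z'" and b': "padd z' b' = Some y"
          using z' by (auto simp: Z_def ea_le_def)
        obtain b'' where b'': "padd t b' = Some b''" "padd z b'' = Some y"
          using assoc_right[OF t b'] .
        then have tb: "padd t b' = Some b"
          using plus_cancel_left[OF b b''(2)] by simp
        have "s d \<le> r" if d: "d \<in> A z'" "ea_le padd d b'" for d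
        proof -
          obtain u where u: "padd z' d = Some u" "ea_le padd u y"
            using plus_le_right[OF b' d(2)] .
          moreover have "ea_le padd u x"
            using d(1) u(1) by (simp add: A_def)
          ultimately show ?thesis
            using le_c[of u] state_plus[OF u(1)] z'(3) by (auto simp: Z_def)
        qed
        then have "part (A z') n b' \<le> n * r"
          by (rule part_le_multiple[OF A_down[OF z'(1)]])
        moreover have "part (A z') n t \<le> s z' - s z"
          using part_le_state[OF A_down[OF z'(1)]] state_plus[OF t] by simp
        ultimately have "part (A z') n b \<le> c - s z + e"
          using part_subadditive[OF A_down[OF z'(1)] tb, of n] r(2) le_c[OF z'(1)] by linarith
        then show ?thesis
          using INF_part_lower[OF F, of "A z'"] z'(1) order_trans by blast
      qed
      then show "(INF B \<in> ?F. part B n b) \<le> c - s z"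
        by (rule field_le_epsilon)
    qed
    \<comment> \<open>Since \<open>s b >= s y - c\<close> for \<open>b = y - z\<close>, this number
      is a lower bound of \<open>?f b\<close> for every \<open>z\<close> in \<open>Z\<close>. A
      \<open>z\<close> with \<open>c - s z\<close> smaller than it contradicts
      \<open>f_small\<close>.\<close>
    have "0 < ?f one * (s y - c)"
      using pos less by simp
    then obtain z where z: "z \<in> Z" "c - ?f one * (s y - c) < s z"
      using exceeds[of "c - ?f one * (s y - c)"] by auto
    obtain b where b: "padd z b = Some y"
      using z(1) by (auto simp: Z_def ea_le_def)
    have "?f one * (s y - c) \<le> ?f one * s b"
      using pos le_c[OF z(1)] state_plus[OF b] by simp
    also have "\<dots> \<le> c - s z"
      using f_small[OF z(1) b] f_eq[of b] by simp
    finally show False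
      using z(2) by simp
  qed
  then have "min (s x) (s y) = c"
    using c_le by linarith
  moreover have "s ` Z = {s z | z. ea_le padd z x \<and> ea_le padd z y}"
    by (auto simp: Z_def)
  ultimately show ?thesis
    by (simp only: c_def)
qed

end

theorem proposition3p3:
  fixes padd :: "'a \<Rightarrow> 'a \<Rightarrow> 'a option" and zero one :: 'a and s :: "'a \<Rightarrow> real"
  assumes "effect_algebra padd zero one"
    and "ea_divisible padd zero"
    and "ea_RDP padd"
    and "ea_state padd one s"
  shows "ea_extremal_state padd one s \<longleftrightarrow>
    (\<forall>x y. min (s x) (s y) = Sup {s z | z. ea_le padd z x \<and> ea_le padd z y})"
proof -
  interpret effect_algebra padd zero one
    by (rule assms(1))
  interpret rdp_effect_algebra_state padd zero one s
    by unfold_locales (rule assms(3,4))+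
  show ?thesis
    using extremal_if_min_formula[OF assms(2)] min_formula_if_extremal by blast
qed

end
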